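(* Let $(\mathfrak h,W)$ be one of the five pairs $(0,\mathbb C)$, $(\mathfrak{sl}_3,S^2\mathbb C^3)$, $(\mathfrak{sl}_3\times\mathfrak{sl}_3,\mathbb C^3\otimes\mathbb C^3)$, $(\mathfrak{sl}_6,\Lambda^2\mathbb C^6)$, $(\mathfrak e_6,\mathbb C^{27})$, let $\mathfrak g=\mathfrak h\oplus\mathbb C\oplus W\oplus W^*$ (respectively $\mathfrak{sl}_2,\mathfrak{sp}_6,\mathfrak{sl}_6,\mathfrak{so}_{12},\mathfrak e_7$) and let $V=\mathbb C\oplus W\oplus W^*\oplus\mathbb C^*$ be the associated simple $\mathfrak g$-module. Let $\Omega$ be the symplectic form on $V$ defined by $$\Omega\big((\alpha,r,r^*,\alpha^* ),(\beta,s,s^*,\beta^* )\big)=6(\alpha\beta^*-\beta\alpha^* )-\big(\langle r,s^*\rangle-\langle s,r^*\rangle\big).$$ Then $\Omega$ is $\mathfrak g$-invariant.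
   Context: $C\in S^3W^*$ is a nonzero $\mathfrak h$-invariant cubic form on $W$ and $C^*\in S^3W$ a dual $\mathfrak h$-invariant cubic on $W^*$ (suitably normalized so that the formulas below define a Lie algebra action). $C(rs)=C(r,s,\cdot)\in W^*$ where $C$ is viewed as a symmetric trilinear form, and similarly $C^*(r^*s^* )\in W$; $\langle\cdot,\cdot\rangle$ is the duality pairing of $W$ and $W^*$. The action of $\mathfrak g$ on $V$: $\mathfrak h$ acts naturally on each summand (trivially on $\mathbb C$ and $\mathbb C^*$); $1\in\mathbb C$ acts by multiplication by $-\frac32,-\frac12,\frac12,\frac32$ on the four summands $\mathbb C,W,W^*,\mathbb C^*$; $t\in W$ and $t^*\in W^*$ act by $$t.(\alpha,r,s^*,\beta^* )=(0,\,3\alpha t,\,C(rt),\,\tfrac12\langle t,s^*\rangle),\qquad t^*.(\alpha,r,s^*,\beta^* )=(\tfrac12\langle r,t^*\rangle,\,C^*(s^*t^* ),\,3\beta^*t^*,\,0).$$ *)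

theory Defs
  imports "HOL-Analysis.Analysis"
begin

section \<open>Complex vector spaces and their duals\<close>

class complex_vector = ab_group_add +
  fixes scaleC :: "complex \<Rightarrow> 'a \<Rightarrow> 'a" (infixr \<open>*\<^sub>C\<close> 75)
  assumes scaleC_add_right: "a *\<^sub>C (x + y) = a *\<^sub>C x + a *\<^sub>C y"
    and scaleC_add_left: "(a + b) *\<^sub>C x = a *\<^sub>C x + b *\<^sub>C x"
    and scaleC_scaleC: "a *\<^sub>C (b *\<^sub>C x) = (a * b) *\<^sub>C x"
    and scaleC_one: "1 *\<^sub>C x = x"

global_interpretation complex_vector: vector_space "scaleC :: complex \<Rightarrow> 'a \<Rightarrow> 'a::complex_vector"
  by unfold_locales (simp_all add: scaleC_add_right scaleC_add_left scaleC_scaleC scaleC_one)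

abbreviation clinear :: "('a::complex_vector \<Rightarrow> 'b::complex_vector) \<Rightarrow> bool" where
  "clinear \<equiv> Vector_Spaces.linear scaleC scaleC"

abbreviation csubspace :: "'a::complex_vector set \<Rightarrow> bool" where
  "csubspace \<equiv> complex_vector.subspace"

abbreviation cdim :: "'a::complex_vector set \<Rightarrow> nat" where
  "cdim \<equiv> complex_vector.dim"

instantiation complex :: complex_vector
begin
definition scaleC_complex :: "complex \<Rightarrow> complex \<Rightarrow> complex" where "scaleC_complex = (*)"
instance by standard (simp_all add: scaleC_complex_def algebra_simps)
end

text \<open>The zero space; it carries the zero Lie algebra.\<close>

instantiation unit :: complex_vector
begin
definition zero_unit :: unit where "zero_unit = ()"
definition plus_unit :: "unit \<Rightarrow> unit \<Rightarrow> unit" where "plus_unit _ _ = ()"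
definition minus_unit :: "unit \<Rightarrow> unit \<Rightarrow> unit" where "minus_unit _ _ = ()"
definition uminus_unit :: "unit \<Rightarrow> unit" where "uminus_unit _ = ()"
definition scaleC_unit :: "complex \<Rightarrow> unit \<Rightarrow> unit" where "scaleC_unit _ _ = ()"
instance by standard simp_all
end

instantiation prod :: (complex_vector, complex_vector) complex_vector
begin
definition scaleC_prod :: "complex \<Rightarrow> 'a \<times> 'b \<Rightarrow> 'a \<times> 'b" where
  "scaleC_prod c p = (c *\<^sub>C fst p, c *\<^sub>C snd p)"
instance
  by standard (simp_all add: scaleC_prod_def scaleC_add_right scaleC_add_left scaleC_scaleC scaleC_one)
end

text \<open>By iteration this also covers matrices \<open>complex ^ 'n ^ 'm\<close>.\<close>

instantiation vec :: (complex_vector, finite) complex_vector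
begin
definition scaleC_vec :: "complex \<Rightarrow> 'a ^ 'b \<Rightarrow> 'a ^ 'b" where
  "scaleC_vec c v = (\<chi> i. c *\<^sub>C (v $ i))"
instance
  by standard (simp_all add: scaleC_vec_def vec_eq_iff scaleC_add_right scaleC_add_left
      scaleC_scaleC scaleC_one)
end

lemma clinear_iff:
  "clinear f \<longleftrightarrow> (\<forall>x y. f (x + y) = f x + f y) \<and> (\<forall>c x. f (c *\<^sub>C x) = c *\<^sub>C f x)"
proof -
  have "vector_space (scaleC :: complex \<Rightarrow> 'a \<Rightarrow> 'a)" "vector_space (scaleC :: complex \<Rightarrow> 'b \<Rightarrow> 'b)"
    by (fact complex_vector.vector_space_axioms)+
  then show ?thesis
    by (auto simp: Vector_Spaces.linear_def module_hom_def module_hom_axioms_def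
        module_iff_vector_space)
qed

typedef (overloaded) 'w dual = "{f :: 'w::complex_vector \<Rightarrow> complex. clinear f}"
  morphisms dual_apply Abs_dual
  by (rule exI[of _ "\<lambda>_. 0"]) (simp add: clinear_iff)

setup_lifting type_definition_dual

instantiation dual :: (complex_vector) complex_vector
begin
lift_definition zero_dual :: "'a dual" is "\<lambda>_. 0"
  by (simp add: clinear_iff)
lift_definition plus_dual :: "'a dual \<Rightarrow> 'a dual \<Rightarrow> 'a dual" is "\<lambda>f g x. f x + g x"
  by (simp add: clinear_iff scaleC_add_right)
lift_definition minus_dual :: "'a dual \<Rightarrow> 'a dual \<Rightarrow> 'a dual" is "\<lambda>f g x. f x - g x"
  by (simp only: clinear_iff) (simp add: scaleC_complex_def algebra_simps)
lift_definition uminus_dual :: "'a dual \<Rightarrow> 'a dual" is "\<lambda>f x. - f x"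
  by (simp only: clinear_iff) (simp add: scaleC_complex_def)
lift_definition scaleC_dual :: "complex \<Rightarrow> 'a dual \<Rightarrow> 'a dual" is "\<lambda>c f x. c *\<^sub>C f x"
  by (simp only: clinear_iff) (simp add: scaleC_complex_def algebra_simps)
instance
  by standard (transfer, simp add: fun_eq_iff scaleC_complex_def algebra_simps)+
end

definition pairing :: "'w::complex_vector \<Rightarrow> 'w dual \<Rightarrow> complex" where
  "pairing r s' = dual_apply s' r"

definition cbilinear :: "('a::complex_vector \<Rightarrow> 'b::complex_vector \<Rightarrow> 'c::complex_vector) \<Rightarrow> bool" where
  "cbilinear f \<longleftrightarrow> (\<forall>x. clinear (f x)) \<and> (\<forall>y. clinear (\<lambda>x. f x y))"

section \<open>Lie algebras and representations\<close>

definition lie_algebra :: "('g::complex_vector \<Rightarrow> 'g \<Rightarrow> 'g) \<Rightarrow> bool" where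
  "lie_algebra br \<longleftrightarrow> cbilinear br \<and> (\<forall>x. br x x = 0) \<and>
     (\<forall>x y z. br x (br y z) + br y (br z x) + br z (br x y) = 0)"

definition lie_rep :: "('g::complex_vector \<Rightarrow> 'g \<Rightarrow> 'g) \<Rightarrow> ('g \<Rightarrow> 'v::complex_vector \<Rightarrow> 'v) \<Rightarrow> bool" where
  "lie_rep br act \<longleftrightarrow> cbilinear act \<and>
     (\<forall>x y v. act (br x y) v = act x (act y v) - act y (act x v))"

definition simple_lie_rep ::
  "('g::complex_vector \<Rightarrow> 'g \<Rightarrow> 'g) \<Rightarrow> ('g \<Rightarrow> 'v::complex_vector \<Rightarrow> 'v) \<Rightarrow> bool" where
  "simple_lie_rep br act \<longleftrightarrow> lie_rep br act \<and> (UNIV :: 'v set) \<noteq> {0} \<and>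
     (\<forall>U. csubspace U \<and> (\<forall>x. \<forall>u\<in>U. act x u \<in> U) \<longrightarrow> U = {0} \<or> U = UNIV)"

definition dual_action ::
  "('h \<Rightarrow> 'w::complex_vector \<Rightarrow> 'w) \<Rightarrow> 'h \<Rightarrow> 'w dual \<Rightarrow> 'w dual" where
  "dual_action act x s' = Abs_dual (\<lambda>w. - dual_apply s' (act x w))"

text \<open>
  In the following two predicates the model Lie algebra and the model module are given by
  subspaces \<open>H\<close>, \<open>M\<close> of ambient types, stable under the model operations.
\<close>

definition lie_iso ::
  "('g::complex_vector \<Rightarrow> 'g \<Rightarrow> 'g) \<Rightarrow> 'k::complex_vector set \<Rightarrow> ('k \<Rightarrow> 'k \<Rightarrow> 'k) \<Rightarrow> ('g \<Rightarrow> 'k) \<Rightarrow> bool" where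
  "lie_iso br H brH \<phi> \<longleftrightarrow> clinear \<phi> \<and> bij_betw \<phi> UNIV H \<and>
     (\<forall>x y. \<phi> (br x y) = brH (\<phi> x) (\<phi> y))"

definition lie_pair_iso ::
  "('h::complex_vector \<Rightarrow> 'h \<Rightarrow> 'h) \<Rightarrow> ('h \<Rightarrow> 'w::complex_vector \<Rightarrow> 'w) \<Rightarrow>
   'k::complex_vector set \<Rightarrow> ('k \<Rightarrow> 'k \<Rightarrow> 'k) \<Rightarrow> 'm::complex_vector set \<Rightarrow> ('k \<Rightarrow> 'm \<Rightarrow> 'm) \<Rightarrow> bool" where
  "lie_pair_iso br act H brH M actM \<longleftrightarrow>
     (\<exists>\<phi> \<psi>. lie_iso br H brH \<phi> \<and> clinear \<psi> \<and> bij_betw \<psi> UNIV M \<and>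
        (\<forall>x w. \<psi> (act x w) = actM (\<phi> x) (\<psi> w)))"

section \<open>Classical Lie algebras and the exceptional types\<close>

definition commutator :: "complex ^ 'n::finite ^ 'n \<Rightarrow> complex ^ 'n ^ 'n \<Rightarrow> complex ^ 'n ^ 'n" where
  "commutator A B = A ** B - B ** A"

definition sl_matrices :: "(complex ^ 'n::finite ^ 'n) set" where
  "sl_matrices = {A. trace A = 0}"

definition so_matrices :: "(complex ^ 'n::finite ^ 'n) set" where
  "so_matrices = {A. transpose A = - A}"

definition symplectic_matrix :: "complex ^ ('n::finite + 'n) ^ ('n + 'n)" where
  "symplectic_matrix = (\<chi> i j. case (i, j) of
      (Inl a, Inr b) \<Rightarrow> (if a = b then 1 else 0)
    | (Inr a, Inl b) \<Rightarrow> (if a = b then -1 else 0)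
    | _ \<Rightarrow> 0)"

definition sp_matrices :: "(complex ^ ('n::finite + 'n) ^ ('n + 'n)) set" where
  "sp_matrices = {A. transpose A ** symplectic_matrix + symplectic_matrix ** A = 0}"

text \<open>
  Bourbaki labelling of the nodes; restricting to the nodes \<open>1, \<dots>, 6\<close> gives \<open>E\<^sub>6\<close>, to
  \<open>1, \<dots>, 7\<close> gives \<open>E\<^sub>7\<close>.
\<close>

definition E_cartan :: "nat \<Rightarrow> nat \<Rightarrow> int" where
  "E_cartan i j =
     (if i = j then 2
      else if {i, j} \<in> {{1,3}, {3,4}, {2,4}, {4,5}, {5,6}, {6,7}} then -1 else 0)"

text \<open>
  Chevalley--Serre description of the simple Lie algebra of type \<open>E\<^sub>n\<close> (\<open>n = 6, 7\<close>).  The algebra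
  presented by the Serre relations is simple, so a nonzero Lie algebra which is generated by
  elements satisfying these relations is isomorphic to it.
\<close>

definition lie_type_E :: "nat \<Rightarrow> ('g::complex_vector \<Rightarrow> 'g \<Rightarrow> 'g) \<Rightarrow> bool" where
  "lie_type_E n br \<longleftrightarrow> lie_algebra br \<and> (UNIV :: 'g set) \<noteq> {0} \<and>
     (\<exists>e f h.
        (\<forall>i\<in>{1..n}. \<forall>j\<in>{1..n}.
            br (h i) (h j) = 0 \<and>
            br (e i) (f j) = (if i = j then h i else 0) \<and>
            br (h i) (e j) = of_int (E_cartan i j) *\<^sub>C e j \<and>
            br (h i) (f j) = - (of_int (E_cartan i j) *\<^sub>C f j) \<and>
            (i \<noteq> j \<longrightarrow>
               (br (e i) ^^ nat (1 - E_cartan i j)) (e j) = 0 \<and>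
               (br (f i) ^^ nat (1 - E_cartan i j)) (f j) = 0)) \<and>
        (\<forall>L. csubspace L \<and> (\<forall>x\<in>L. \<forall>y\<in>L. br x y \<in> L) \<and>
             (\<forall>i\<in>{1..n}. e i \<in> L \<and> f i \<in> L \<and> h i \<in> L) \<longrightarrow> L = UNIV))"

section \<open>The five cases\<close>

text \<open>
  Tensors in \<open>\<complex>\<^sup>n \<otimes> \<complex>\<^sup>n\<close> are identified with matrices by \<open>x \<otimes> y \<mapsto> x y\<^sup>T\<close>, so that
  \<open>A \<otimes> 1 + 1 \<otimes> B\<close> becomes \<open>M \<mapsto> A M + M B\<^sup>T\<close>, and \<open>S\<^sup>2\<close>, \<open>\<Lambda>\<^sup>2\<close> consist of the symmetric and the
  skew-symmetric matrices.
\<close>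

definition tensor_action ::
  "(complex ^ 'n::finite ^ 'n) \<times> (complex ^ 'n ^ 'n) \<Rightarrow> complex ^ 'n ^ 'n \<Rightarrow> complex ^ 'n ^ 'n" where
  "tensor_action p M = fst p ** M + M ** transpose (snd p)"

definition five_cases ::
  "('h::complex_vector \<Rightarrow> 'h \<Rightarrow> 'h) \<Rightarrow> ('h \<Rightarrow> 'w::complex_vector \<Rightarrow> 'w) \<Rightarrow>
   ('g::complex_vector \<Rightarrow> 'g \<Rightarrow> 'g) \<Rightarrow> bool" where
  "five_cases brh act brg \<longleftrightarrow>
     \<comment> \<open>\<open>(0, \<complex>)\<close>, \<open>sl\<^sub>2\<close>\<close>
     (lie_pair_iso brh act {0 :: complex} (\<lambda>_ _. 0) (UNIV :: complex set) (\<lambda>_ _. 0) \<and>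
      (\<exists>\<phi>. lie_iso brg (sl_matrices :: (complex^2^2) set) commutator \<phi>)) \<or>
     \<comment> \<open>\<open>(sl\<^sub>3, S\<^sup>2 \<complex>\<^sup>3)\<close>, \<open>sp\<^sub>6\<close>\<close>
     (lie_pair_iso brh act (sl_matrices :: (complex^3^3) set) commutator
        {M. transpose M = M} (\<lambda>A. tensor_action (A, A)) \<and>
      (\<exists>\<phi>. lie_iso brg (sp_matrices :: (complex^(3 + 3)^(3 + 3)) set) commutator \<phi>)) \<or>
     \<comment> \<open>\<open>(sl\<^sub>3 \<times> sl\<^sub>3, \<complex>\<^sup>3 \<otimes> \<complex>\<^sup>3)\<close>, \<open>sl\<^sub>6\<close>\<close>
     (lie_pair_iso brh act ((sl_matrices :: (complex^3^3) set) \<times> sl_matrices)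
        (\<lambda>p q. (commutator (fst p) (fst q), commutator (snd p) (snd q)))
        UNIV tensor_action \<and>
      (\<exists>\<phi>. lie_iso brg (sl_matrices :: (complex^6^6) set) commutator \<phi>)) \<or>
     \<comment> \<open>\<open>(sl\<^sub>6, \<Lambda>\<^sup>2 \<complex>\<^sup>6)\<close>, \<open>so\<^sub>1\<^sub>2\<close>\<close>
     (lie_pair_iso brh act (sl_matrices :: (complex^6^6) set) commutator
        {M. transpose M = - M} (\<lambda>A. tensor_action (A, A)) \<and>
      (\<exists>\<phi>. lie_iso brg (so_matrices :: (complex^12^12) set) commutator \<phi>)) \<or>
     \<comment> \<open>\<open>(e\<^sub>6, \<complex>\<^sup>2\<^sup>7)\<close>, \<open>e\<^sub>7\<close>: the irreducible modules of dimension 27 are the minuscule module and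
        its dual, which differ by an automorphism of \<open>e\<^sub>6\<close>\<close>
     (lie_type_E 6 brh \<and> simple_lie_rep brh act \<and> cdim (UNIV :: 'w set) = 27 \<and>
      lie_type_E 7 brg)"

section \<open>Cubic forms, the module \<open>V\<close> and the form \<open>\<Omega>\<close>\<close>

text \<open>
  A cubic form is given by its polarization, a symmetric trilinear form.  An element of \<open>S\<^sup>3 W\<close> is
  regarded as a cubic form on \<open>W\<^sup>*\<close>.
\<close>

definition symmetric_trilinear :: "('a::complex_vector \<Rightarrow> 'a \<Rightarrow> 'a \<Rightarrow> complex) \<Rightarrow> bool" where
  "symmetric_trilinear F \<longleftrightarrow> (\<forall>x y. clinear (F x y)) \<and>
     (\<forall>x y z. F x y z = F y x z) \<and> (\<forall>x y z. F x y z = F x z y)"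

definition invariant_cubic ::
  "('h \<Rightarrow> 'a::complex_vector \<Rightarrow> 'a) \<Rightarrow> ('a \<Rightarrow> 'a \<Rightarrow> 'a \<Rightarrow> complex) \<Rightarrow> bool" where
  "invariant_cubic act F \<longleftrightarrow> symmetric_trilinear F \<and>
     (\<forall>a x y z. F (act a x) y z + F x (act a y) z + F x y (act a z) = 0)"

definition cubic_W :: "('w::complex_vector \<Rightarrow> 'w \<Rightarrow> 'w \<Rightarrow> complex) \<Rightarrow> 'w \<Rightarrow> 'w \<Rightarrow> 'w dual" where
  "cubic_W C r s = Abs_dual (C r s)"

text \<open>The linear form \<open>C\<^sup>*(r\<^sup>*, s\<^sup>*, \<cdot>)\<close> on \<open>W\<^sup>*\<close>, as an element of the finite-dimensional space \<open>W\<close>.\<close>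

definition cubic_W_dual ::
  "('w::complex_vector dual \<Rightarrow> 'w dual \<Rightarrow> 'w dual \<Rightarrow> complex) \<Rightarrow> 'w dual \<Rightarrow> 'w dual \<Rightarrow> 'w" where
  "cubic_W_dual C' r' s' = (THE w. \<forall>u'. pairing w u' = C' r' s' u')"

text \<open>
  Only the underlying space of \<open>\<gg>\<close>; its bracket is a parameter, required to make \<open>g_act\<close> below a
  representation.  As \<open>\<gg>\<close> acts faithfully on \<open>V\<close>, this determines the bracket, and it is the
  condition that fixes the relative normalization of \<open>C\<close> and \<open>C\<^sup>*\<close>.
\<close>

type_synonym ('h, 'w) g_space = "'h \<times> complex \<times> 'w \<times> 'w dual"

text \<open>The one-dimensional summand \<open>\<complex>\<^sup>*\<close> is identified with \<open>\<complex>\<close> by evaluation at \<open>1\<close>.\<close>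

type_synonym 'w V_space = "complex \<times> 'w \<times> 'w dual \<times> complex"

definition h_act :: "('h \<Rightarrow> 'w::complex_vector \<Rightarrow> 'w) \<Rightarrow> 'h \<Rightarrow> 'w V_space \<Rightarrow> 'w V_space" where
  "h_act act a = (\<lambda>(\<alpha>, r, s', \<beta>'). (0, act a r, dual_action act a s', 0))"

definition C_act :: "complex \<Rightarrow> 'w::complex_vector V_space \<Rightarrow> 'w V_space" where
  "C_act c = (\<lambda>(\<alpha>, r, s', \<beta>').
     c *\<^sub>C (- (3/2) * \<alpha>, - (1/2) *\<^sub>C r, (1/2) *\<^sub>C s', (3/2) * \<beta>'))"

definition W_act ::
  "('w::complex_vector \<Rightarrow> 'w \<Rightarrow> 'w \<Rightarrow> complex) \<Rightarrow> 'w \<Rightarrow> 'w V_space \<Rightarrow> 'w V_space" where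
  "W_act C t = (\<lambda>(\<alpha>, r, s', \<beta>'). (0, (3 * \<alpha>) *\<^sub>C t, cubic_W C r t, 1/2 * pairing t s'))"

definition W_dual_act ::
  "('w::complex_vector dual \<Rightarrow> 'w dual \<Rightarrow> 'w dual \<Rightarrow> complex) \<Rightarrow> 'w dual \<Rightarrow> 'w V_space \<Rightarrow> 'w V_space" where
  "W_dual_act C' t' = (\<lambda>(\<alpha>, r, s', \<beta>').
     (1/2 * pairing r t', cubic_W_dual C' s' t', (3 * \<beta>') *\<^sub>C t', 0))"

definition g_act ::
  "('h \<Rightarrow> 'w::complex_vector \<Rightarrow> 'w) \<Rightarrow> ('w \<Rightarrow> 'w \<Rightarrow> 'w \<Rightarrow> complex) \<Rightarrow>
   ('w dual \<Rightarrow> 'w dual \<Rightarrow> 'w dual \<Rightarrow> complex) \<Rightarrow>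
   ('h, 'w) g_space \<Rightarrow> 'w V_space \<Rightarrow> 'w V_space" where
  "g_act act C C' = (\<lambda>(a, c, t, t') v. h_act act a v + C_act c v + W_act C t v + W_dual_act C' t' v)"

definition Omega :: "'w::complex_vector V_space \<Rightarrow> 'w V_space \<Rightarrow> complex" where
  "Omega = (\<lambda>(\<alpha>, r, r', \<alpha>') (\<beta>, s, s', \<beta>').
     6 * (\<alpha> * \<beta>' - \<beta> * \<alpha>') - (pairing r s' - pairing s r'))"

definition invariant_form :: "('g \<Rightarrow> 'v \<Rightarrow> 'v) \<Rightarrow> ('v \<Rightarrow> 'v \<Rightarrow> complex) \<Rightarrow> bool" where
  "invariant_form act F \<longleftrightarrow> (\<forall>x v w. F (act x v) w + F v (act x w) = 0)"

end

theory Submission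
  imports Defs
begin

text \<open>
  Invariance is linear in the element of \<open>\<gg>\<close>, so it may be checked separately on the summands
  \<open>\<hh>\<close>, \<open>\<complex>\<close>, \<open>W\<close> and \<open>W\<^sup>*\<close>.  On \<open>\<hh>\<close> it holds because the action on \<open>W\<^sup>*\<close> is contragredient,
  and on \<open>\<complex>\<close> because \<open>\<Omega>\<close> pairs only summands of opposite weight.  On \<open>t \<in> W\<close> the terms that
  involve \<open>\<langle>t, \<cdot>\<rangle>\<close> cancel in pairs since \<open>6 \<cdot> \<onehalf> = 3\<close>: this is where the coefficient \<open>6\<close> of
  \<open>\<Omega>\<close> comes from.  What remains is \<open>C(r, t, s) - C(s, t, r)\<close>, which vanishes by symmetry of \<open>C\<close>.  The
  summand \<open>W\<^sup>*\<close> is handled in the same way.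

  The one point that requires an argument is that \<open>C\<^sup>*(r\<^sup>*s\<^sup>*)\<close> really is the vector of \<open>W\<close>
  representing the linear form \<open>C\<^sup>*(r\<^sup>*, s\<^sup>*, \<cdot>)\<close> on \<open>W\<^sup>*\<close>
  (\<open>pairing_cubic_W_dual\<close>).  This is reflexivity of \<open>W\<close> and rests on \<open>dim W < \<infinity>\<close>
  (\<open>five_cases_finite_dimensional\<close>).  The latter is read off from the
  list of cases: in four of them \<open>W\<close> embeds linearly into a space of scalars or matrices, in the
  last one its dimension is \<open>27\<close>.
\<close>

section \<open>Finite-dimensional spaces and reflexivity\<close>

definition finite_dimensional :: "'a::complex_vector itself \<Rightarrow> bool" where
  "finite_dimensional _ \<longleftrightarrow> (\<exists>B :: 'a set. finite B \<and> complex_vector.span B = UNIV)"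

text \<open>
  Applied form of the definition: it leaves the scalar multiplication that is an argument of
  \<open>clinear\<close> alone, so that \<open>clinear_iff\<close> still applies.
\<close>

lemma scaleC_complex_eq: "c *\<^sub>C x = c * x" for x :: complex
  by (simp add: scaleC_complex_def)

lemma finite_dimensional_complex: "finite_dimensional TYPE(complex)"
proof -
  have "x \<in> complex_vector.span {1}" for x :: complex
  proof -
    have "x *\<^sub>C 1 \<in> complex_vector.span {1 :: complex}"
      by (intro complex_vector.span_scale complex_vector.span_base) simp
    then show ?thesis
      by (simp only: scaleC_complex_eq mult_1_right)
  qed
  then show ?thesis
    unfolding finite_dimensional_def by (intro exI[of _ "{1}"]) auto
qed

lemma finite_dimensional_vec:
  assumes "finite_dimensional TYPE('a::complex_vector)"
  shows "finite_dimensional TYPE('a ^ 'n::finite)"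
proof -
  obtain B :: "'a set" where B: "finite B" "complex_vector.span B = UNIV"
    using assms by (auto simp: finite_dimensional_def)
  let ?B = "\<Union>i::'n. axis i ` B"
  have axis: "clinear (axis i :: 'a \<Rightarrow> 'a ^ 'n)" for i
    by (auto simp: clinear_iff vec_eq_iff axis_def scaleC_vec_def)
  have "axis i x \<in> complex_vector.span ?B" for i :: 'n and x
  proof -
    have "axis i x \<in> axis i ` complex_vector.span B"
      using B by simp
    also have "\<dots> = complex_vector.span (axis i ` B)"
      using module_hom.span_image[of scaleC scaleC "axis i" B] axis[of i]
      by (simp add: linear_iff_module_hom)
    also have "\<dots> \<subseteq> complex_vector.span ?B"
      by (intro complex_vector.span_mono) auto
    finally show ?thesis .
  qed
  then have "(\<Sum>i\<in>UNIV. axis i (v $ i)) \<in> complex_vector.span ?B" for v :: "'a ^ 'n"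
    by (intro complex_vector.span_sum)
  moreover have "(\<Sum>i\<in>UNIV. axis i (v $ i)) = v" for v :: "'a ^ 'n"
    by (simp add: vec_eq_iff axis_def)
  ultimately have "complex_vector.span ?B = UNIV"
    by auto
  moreover have "finite ?B"
    using B by simp
  ultimately show ?thesis
    unfolding finite_dimensional_def by blast
qed

lemma finite_dimensional_if_clinear_inj:
  fixes f :: "'a::complex_vector \<Rightarrow> 'b::complex_vector"
  assumes f: "clinear f" "inj f" and fin: "finite_dimensional TYPE('b)"
  shows "finite_dimensional TYPE('a)"
proof -
  interpret f: Vector_Spaces.linear scaleC scaleC f
    by (fact f)
  obtain B :: "'a set" where B: "complex_vector.independent B" "UNIV \<subseteq> complex_vector.span B"
    using complex_vector.basis_exists[of UNIV] by metis
  obtain D :: "'b set" where D: "finite D" "complex_vector.span D = UNIV"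
    using fin by (auto simp: finite_dimensional_def)
  have "complex_vector.independent (f ` B)"
    using f.independent_injective_image[OF B(1)] f(2) by (simp add: inj_on_subset)
  then have "finite (f ` B)"
    using complex_vector.independent_span_bound[OF D(1)] D(2) by blast
  then have "finite B"
    using f(2) by (meson finite_imageD inj_on_subset subset_UNIV)
  with B(2) show ?thesis
    unfolding finite_dimensional_def by blast
qed

text \<open>\<open>dim\<close> takes the default value \<open>0\<close> on infinite-dimensional spaces.\<close>

lemma finite_dimensional_if_cdim:
  assumes "cdim (UNIV :: 'a::complex_vector set) \<noteq> 0"
  shows "finite_dimensional TYPE('a)"
proof -
  obtain B :: "'a set" where "UNIV \<subseteq> complex_vector.span B" "card B = cdim (UNIV :: 'a set)"
    using complex_vector.basis_exists[of UNIV] by metis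
  with assms show ?thesis
    unfolding finite_dimensional_def by (metis card.infinite top.extremum_uniqueI)
qed

lemma pairing_simps [simp]:
  "pairing (r + s) u = pairing r u + pairing s u"
  "pairing (c *\<^sub>C r) u = c * pairing r u"
  "pairing 0 u = 0"
  "pairing (- r) u = - pairing r u"
  "pairing r (u + v) = pairing r u + pairing r v"
  "pairing r (c *\<^sub>C u) = c * pairing r u"
  "pairing r 0 = 0"
proof -
  have u: "clinear (dual_apply u)"
    using dual_apply by auto
  show add: "pairing (r + s) u = pairing r u + pairing s u" for r s
    using u by (simp add: pairing_def clinear_iff)
  show "pairing (c *\<^sub>C r) u = c * pairing r u"
    using u by (simp add: pairing_def clinear_iff scaleC_complex_eq)
  show zero: "pairing 0 u = 0"
    using add[of 0 0] by simp
  show "pairing (- r) u = - pairing r u"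
    using add[of "- r" r] zero by (simp add: eq_neg_iff_add_eq_0)
qed (simp_all add: pairing_def plus_dual.rep_eq scaleC_dual.rep_eq zero_dual.rep_eq
      scaleC_complex_eq)

lemma pairing_sum_left: "pairing (sum f A) u = (\<Sum>a\<in>A. pairing (f a) u)"
  by (induction A rule: infinite_finite_induct) simp_all

lemma pairing_sum_right: "pairing r (sum f A) = (\<Sum>a\<in>A. pairing r (f a))"
  by (induction A rule: infinite_finite_induct) simp_all

lemma pairing_Abs_dual: "clinear f \<Longrightarrow> pairing r (Abs_dual f) = f r"
  by (simp add: pairing_def Abs_dual_inverse)

lemma dual_eqI: "(\<And>r. pairing r u = pairing r v) \<Longrightarrow> u = v"
  by (simp add: pairing_def dual_apply_inject[symmetric] fun_eq_iff)

text \<open>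
  The coordinate forms of a basis \<open>B\<close> of \<open>W\<close> span \<open>W\<^sup>*\<close>, by \<open>u = (\<Sum>b\<in>B. u(b) b\<^sup>*)\<close>.
  Hence \<open>F\<close> is evaluation at \<open>\<Sum>b\<in>B. F(b\<^sup>*) b\<close>.  The coordinate forms also separate points, which
  gives uniqueness.
\<close>

lemma finite_dimensional_reflexive:
  fixes F :: "'w::complex_vector dual \<Rightarrow> complex"
  assumes "finite_dimensional TYPE('w)" and F: "clinear F"
  shows "\<exists>!w. \<forall>u. pairing w u = F u"
proof -
  interpret F: Vector_Spaces.linear scaleC scaleC F
    by (fact F)
  obtain S :: "'w set" where S: "finite S" "complex_vector.span S = UNIV"
    using assms(1) by (auto simp: finite_dimensional_def)
  obtain B :: "'w set" where B: "complex_vector.independent B" "UNIV \<subseteq> complex_vector.span B"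
    using complex_vector.basis_exists[of UNIV] by metis
  have finB: "finite B"
    using complex_vector.independent_span_bound[OF S(1) B(1)] S(2) by simp
  have span: "x \<in> complex_vector.span B" for x
    using B(2) by blast
  define coord where "coord b = Abs_dual (\<lambda>x. complex_vector.representation B x b)" for b
  have pairing_coord: "pairing x (coord b) = complex_vector.representation B x b" for x b
    unfolding coord_def
    by (rule pairing_Abs_dual)
      (simp add: clinear_iff scaleC_complex_eq complex_vector.representation_add[OF B(1) span span]
        complex_vector.representation_scale[OF B(1) span])
  have expand: "(\<Sum>b\<in>B. pairing x (coord b) *\<^sub>C b) = x" for x
    unfolding pairing_coord
    by (rule complex_vector.sum_representation_eq[OF B(1) span finB order_refl])
  have expand_dual: "(\<Sum>b\<in>B. pairing b u *\<^sub>C coord b) = u" for u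
  proof (rule dual_eqI)
    fix r
    have "pairing r u = pairing (\<Sum>b\<in>B. pairing r (coord b) *\<^sub>C b) u"
      by (simp add: expand)
    then show "pairing r (\<Sum>b\<in>B. pairing b u *\<^sub>C coord b) = pairing r u"
      by (simp add: pairing_sum_left pairing_sum_right mult.commute)
  qed
  show ?thesis
  proof (rule ex1I)
    show "\<forall>u. pairing (\<Sum>b\<in>B. F (coord b) *\<^sub>C b) u = F u"
    proof
      fix u
      have "F u = F (\<Sum>b\<in>B. pairing b u *\<^sub>C coord b)"
        by (simp add: expand_dual)
      also have "\<dots> = (\<Sum>b\<in>B. pairing b u * F (coord b))"
        by (simp add: F.sum F.scale scaleC_complex_eq)
      finally show "pairing (\<Sum>b\<in>B. F (coord b) *\<^sub>C b) u = F u"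
        by (simp add: pairing_sum_left mult.commute)
    qed
  next
    fix w
    assume "\<forall>u. pairing w u = F u"
    then show "w = (\<Sum>b\<in>B. F (coord b) *\<^sub>C b)"
      using expand[of w] by simp
  qed
qed

section \<open>The cubic forms\<close>

lemma five_cases_finite_dimensional:
  fixes act :: "'h::complex_vector \<Rightarrow> 'w::complex_vector \<Rightarrow> 'w"
  assumes "five_cases brh act brg"
  shows "finite_dimensional TYPE('w)"
proof -
  have pair: "finite_dimensional TYPE('w)"
    if "lie_pair_iso brh act H brH M actM" "finite_dimensional TYPE('m)"
    for H :: "'k::complex_vector set" and brH and M :: "'m::complex_vector set" and actM
    using that finite_dimensional_if_clinear_inj
    by (auto simp: lie_pair_iso_def bij_betw_def)
  note matrices = finite_dimensional_vec[OF finite_dimensional_vec[OF finite_dimensional_complex]]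
  show ?thesis
    using assms unfolding five_cases_def
    by (elim disjE conjE)
      ((erule pair, rule finite_dimensional_complex matrices)
        | (rule finite_dimensional_if_cdim, simp))+
qed

lemma pairing_cubic_W:
  assumes "symmetric_trilinear C"
  shows "pairing u (cubic_W C r s) = C r s u"
  using assms by (simp add: cubic_W_def pairing_Abs_dual symmetric_trilinear_def)

lemma pairing_cubic_W_dual:
  fixes C' :: "'w::complex_vector dual \<Rightarrow> 'w dual \<Rightarrow> 'w dual \<Rightarrow> complex"
  assumes "finite_dimensional TYPE('w)" and "symmetric_trilinear C'"
  shows "pairing (cubic_W_dual C' r' s') u' = C' r' s' u'"
proof -
  have "clinear (C' r' s')"
    using assms(2) by (simp add: symmetric_trilinear_def)
  from theI'[OF finite_dimensional_reflexive[OF assms(1) this]] show ?thesis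
    by (simp add: cubic_W_dual_def)
qed

lemma pairing_dual_action:
  assumes "clinear (act a)"
  shows "pairing r (dual_action act a s') = - pairing (act a r) s'"
proof -
  have "clinear (\<lambda>w. - pairing (act a w) s')"
    using assms by (simp add: clinear_iff scaleC_complex_eq)
  then show ?thesis
    unfolding dual_action_def pairing_def[symmetric] by (simp add: pairing_Abs_dual)
qed

section \<open>Invariance on the four summands\<close>

text \<open>
  Stated for a single operator, so that additivity in the operator reduces the invariance under
  \<open>\<gg>\<close> to that under each of its summands.
\<close>

definition Omega_skew :: "('w::complex_vector V_space \<Rightarrow> 'w V_space) \<Rightarrow> bool" where
  "Omega_skew f \<longleftrightarrow> (\<forall>v w. Omega (f v) w + Omega v (f w) = 0)"

lemma Omega_skew_add:
  assumes "Omega_skew f" and "Omega_skew g"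
  shows "Omega_skew (\<lambda>v. f v + g v)"
proof -
  have "Omega (u + v) w = Omega u w + Omega v w" for u v w :: "'a V_space"
    by (cases u; cases v; cases w) (simp add: Omega_def algebra_simps)
  moreover have "Omega w (u + v) = Omega w u + Omega w v" for u v w :: "'a V_space"
    by (cases u; cases v; cases w) (simp add: Omega_def algebra_simps)
  ultimately have "Omega (f v + g v) w + Omega v (f w + g w)
      = (Omega (f v) w + Omega v (f w)) + (Omega (g v) w + Omega v (g w))" for v w
    by simp
  with assms show ?thesis
    by (simp add: Omega_skew_def)
qed

lemma Omega_skew_h_act:
  assumes "clinear (act a)"
  shows "Omega_skew (h_act act a)"
  by (auto simp: Omega_skew_def Omega_def h_act_def pairing_dual_action[of act a, OF assms])

lemma Omega_skew_C_act: "Omega_skew (C_act c)"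
  by (auto simp: Omega_skew_def Omega_def C_act_def scaleC_prod_def scaleC_complex_eq
      field_simps)

lemma Omega_skew_W_act:
  assumes "symmetric_trilinear C"
  shows "Omega_skew (W_act C t)"
proof -
  have "C r t s = C s t r" for r s
    using assms unfolding symmetric_trilinear_def by metis
  then show ?thesis
    by (auto simp: Omega_skew_def Omega_def W_act_def pairing_cubic_W[OF assms] algebra_simps)
qed

lemma Omega_skew_W_dual_act:
  fixes C' :: "'w::complex_vector dual \<Rightarrow> 'w dual \<Rightarrow> 'w dual \<Rightarrow> complex"
  assumes "finite_dimensional TYPE('w)" and "symmetric_trilinear C'"
  shows "Omega_skew (W_dual_act C' t')"
proof -
  have "C' r' t' s' = C' s' t' r'" for r' s'
    using assms(2) unfolding symmetric_trilinear_def by metis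
  then show ?thesis
    by (auto simp: Omega_skew_def Omega_def W_dual_act_def pairing_cubic_W_dual[OF assms]
        algebra_simps)
qed

theorem proposition5p4:
  fixes brh :: "'h::complex_vector \<Rightarrow> 'h \<Rightarrow> 'h"
    and act :: "'h \<Rightarrow> 'w::complex_vector \<Rightarrow> 'w"
    and brg :: "('h, 'w) g_space \<Rightarrow> ('h, 'w) g_space \<Rightarrow> ('h, 'w) g_space"
    and C :: "'w \<Rightarrow> 'w \<Rightarrow> 'w \<Rightarrow> complex"
    and C' :: "'w dual \<Rightarrow> 'w dual \<Rightarrow> 'w dual \<Rightarrow> complex"
  assumes "lie_algebra brh" and "lie_rep brh act"
    and "lie_algebra brg"
    and "five_cases brh act brg"
    and "invariant_cubic act C" and "\<exists>r s t. C r s t \<noteq> 0"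
    and "invariant_cubic (dual_action act) C'" and "\<exists>r' s' t'. C' r' s' t' \<noteq> 0"
    and "simple_lie_rep brg (g_act act C C')"
  shows "invariant_form (g_act act C C') Omega"
proof -
  have act: "clinear (act a)" for a
    using assms(2) by (simp add: lie_rep_def cbilinear_def)
  have sym: "symmetric_trilinear C" "symmetric_trilinear C'"
    using assms(5,7) by (simp_all add: invariant_cubic_def)
  have fin: "finite_dimensional TYPE('w)"
    using assms(4) by (rule five_cases_finite_dimensional)
  have "Omega_skew (g_act act C C' x)" for x
  proof (cases x)
    case (fields a c t t')
    show ?thesis
      unfolding fields g_act_def prod.case
      by (intro Omega_skew_add Omega_skew_h_act Omega_skew_C_act Omega_skew_W_act
          Omega_skew_W_dual_act act sym fin)
  qed
  then show ?thesis
    by (simp add: invariant_form_def Omega_skew_def)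
qed

end
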